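(* Let $G$ be a near-triangulation that does not contain the complete graph $K_4$ as an induced subgraph. Then $G$ is $3$-colourable if and only if $G$ is word-representable.
   Context: A graph $G=(V,E)$ is word-representable if there exists a word $w$ over the alphabet $V$ such that for all distinct $x,y\in V$, the letters $x$ and $y$ alternate in $w$ if and only if $(x,y)\in E$. A near-triangulation is a (finite) planar graph, given with a plane embedding, in which every bounded (inner) face is a triangle; the outer face need not be a triangle. A graph is $3$-colourable if its vertices can be coloured with at most $3$ colours so that adjacent vertices receive different colours. *)

theory Defs
  imports "HOL-Analysis.Analysis"
begin

definition simple_graph :: "'v set \<Rightarrow> ('v \<Rightarrow> 'v \<Rightarrow> bool) \<Rightarrow> bool" where
  "simple_graph V E \<longleftrightarrow> finite V \<and>
     (\<forall>x y. E x y \<longrightarrow> x \<in> V \<and> y \<in> V) \<and>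
     (\<forall>x y. E x y \<longrightarrow> E y x) \<and> (\<forall>x. \<not> E x x)"

definition alternate :: "'v list \<Rightarrow> 'v \<Rightarrow> 'v \<Rightarrow> bool" where
  "alternate w x y \<longleftrightarrow>
     (let u = filter (\<lambda>c. c = x \<or> c = y) w in
        \<forall>i. Suc i < length u \<longrightarrow> u ! i \<noteq> u ! Suc i)"

definition word_representable :: "'v set \<Rightarrow> ('v \<Rightarrow> 'v \<Rightarrow> bool) \<Rightarrow> bool" where
  "word_representable V E \<longleftrightarrow>
     (\<exists>w :: 'v list. set w = V \<and>
        (\<forall>x\<in>V. \<forall>y\<in>V. x \<noteq> y \<longrightarrow> (alternate w x y \<longleftrightarrow> E x y)))"

definition three_colourable :: "'v set \<Rightarrow> ('v \<Rightarrow> 'v \<Rightarrow> bool) \<Rightarrow> bool" where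
  "three_colourable V E \<longleftrightarrow>
     (\<exists>c :: 'v \<Rightarrow> nat. (\<forall>v\<in>V. c v < 3) \<and>
        (\<forall>x\<in>V. \<forall>y\<in>V. E x y \<longrightarrow> c x \<noteq> c y))"

definition has_induced_K4 :: "'v set \<Rightarrow> ('v \<Rightarrow> 'v \<Rightarrow> bool) \<Rightarrow> bool" where
  "has_induced_K4 V E \<longleftrightarrow>
     (\<exists>a\<in>V. \<exists>b\<in>V. \<exists>c\<in>V. \<exists>d\<in>V. distinct [a, b, c, d] \<and>
        E a b \<and> E a c \<and> E a d \<and> E b c \<and> E b d \<and> E c d)"

definition plane_embedding ::
  "'v set \<Rightarrow> ('v \<Rightarrow> 'v \<Rightarrow> bool) \<Rightarrow> ('v \<Rightarrow> complex) \<Rightarrow> ('v \<Rightarrow> 'v \<Rightarrow> real \<Rightarrow> complex) \<Rightarrow> bool" where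
  "plane_embedding V E p \<gamma> \<longleftrightarrow>
     inj_on p V \<and>
     (\<forall>x y. E x y \<longrightarrow> arc (\<gamma> x y) \<and> pathstart (\<gamma> x y) = p x \<and> pathfinish (\<gamma> x y) = p y
                     \<and> \<gamma> y x = reversepath (\<gamma> x y)) \<and>
     (\<forall>x y u v. E x y \<and> E u v \<and> {x, y} \<noteq> {u, v} \<longrightarrow>
        path_image (\<gamma> x y) \<inter> path_image (\<gamma> u v) \<subseteq> p ` ({x, y} \<inter> {u, v})) \<and>
     (\<forall>x y z. E x y \<and> z \<in> V \<and> z \<noteq> x \<and> z \<noteq> y \<longrightarrow> p z \<notin> path_image (\<gamma> x y))"

definition drawing ::
  "'v set \<Rightarrow> ('v \<Rightarrow> 'v \<Rightarrow> bool) \<Rightarrow> ('v \<Rightarrow> complex) \<Rightarrow> ('v \<Rightarrow> 'v \<Rightarrow> real \<Rightarrow> complex) \<Rightarrow> complex set" where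
  "drawing V E p \<gamma> = p ` V \<union> \<Union> {path_image (\<gamma> x y) | x y. E x y}"

definition faces ::
  "'v set \<Rightarrow> ('v \<Rightarrow> 'v \<Rightarrow> bool) \<Rightarrow> ('v \<Rightarrow> complex) \<Rightarrow> ('v \<Rightarrow> 'v \<Rightarrow> real \<Rightarrow> complex) \<Rightarrow> complex set set" where
  "faces V E p \<gamma> =
     {connected_component_set (- drawing V E p \<gamma>) z | z. z \<notin> drawing V E p \<gamma>}"

definition triangular_face ::
  "'v set \<Rightarrow> ('v \<Rightarrow> 'v \<Rightarrow> bool) \<Rightarrow> ('v \<Rightarrow> 'v \<Rightarrow> real \<Rightarrow> complex) \<Rightarrow> complex set \<Rightarrow> bool" where
  "triangular_face V E \<gamma> F \<longleftrightarrow>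
     (\<exists>a\<in>V. \<exists>b\<in>V. \<exists>c\<in>V. distinct [a, b, c] \<and> E a b \<and> E b c \<and> E c a \<and>
        frontier F = path_image (\<gamma> a b) \<union> path_image (\<gamma> b c) \<union> path_image (\<gamma> c a))"

definition near_triangulation :: "'v set \<Rightarrow> ('v \<Rightarrow> 'v \<Rightarrow> bool) \<Rightarrow> bool" where
  "near_triangulation V E \<longleftrightarrow> simple_graph V E \<and>
     (\<exists>p \<gamma>. plane_embedding V E p \<gamma> \<and>
        (\<forall>F \<in> faces V E p \<gamma>. bounded F \<longrightarrow> triangular_face V E \<gamma> F))"

end

theory Submission
  imports Defs "HOL-Library.Transitive_Closure_Table" "HOL-Library.Z2"
begin

text \<open>
  In a 3-colourable graph there is for each vertex \<open>v\<close> a word in which all edges alternate with the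
  smaller colour first, but no non-neighbour of \<open>v\<close> alternates with \<open>v\<close>; the concatenation of these
  words represents the graph.

  Conversely, let a word represent \<open>G\<close>. The letters adjacent to \<open>v\<close> recur in a fixed cyclic order
  relative to \<open>v\<close>, and this makes the neighbourhood of \<open>v\<close> the comparability graph of a partial
  order. If \<open>G\<close> has no \<open>K\<^sub>4\<close>, the order has no chain of three elements, so separating its minimal
  elements from the others gives a 2-colouring \<open>b v\<close> of the neighbourhood with values in \<open>\<int>/2\<close>.

  In a near-triangulation a 1-cocycle, that is an antisymmetric function on oriented edges that sums
  to zero around triangles, is a coboundary: a cycle with nonzero sum and minimal interior could be
  shrunk across the triangular face that lies inside it along one of its edges. Now
  \<open>b x y + b y x + 1\<close> is a cocycle over \<open>\<int>/2\<close>, so after adding a potential to \<open>b\<close> we may assume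
  \<open>b x y \<noteq> b y x\<close> on all edges. Then the function with value \<open>1\<close> or \<open>-1\<close> in \<open>\<int>/3\<close> on \<open>(x, y)\<close>
  according to \<open>b x y\<close> is a cocycle as well, and its potential is a proper 3-colouring.
\<close>

lemma simple_graph_finite: "simple_graph V E \<Longrightarrow> finite V"
  and simple_graph_in_vertices: "simple_graph V E \<Longrightarrow> E x y \<Longrightarrow> x \<in> V \<and> y \<in> V"
  and simple_graph_sym: "simple_graph V E \<Longrightarrow> E x y \<Longrightarrow> E y x"
  and simple_graph_irrefl: "simple_graph V E \<Longrightarrow> \<not> E x x"
  by (simp_all add: simple_graph_def)

section \<open>Words for 3-coloured graphs\<close>

abbreviation pair_subword :: "'v \<Rightarrow> 'v \<Rightarrow> 'v list \<Rightarrow> 'v list" where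
  "pair_subword x y \<equiv> filter (\<lambda>z. z = x \<or> z = y)"

lemma pair_subword_commute: "pair_subword x y w = pair_subword y x w"
  by (simp add: disj_commute)

lemma pair_subword_distinct:
  assumes "distinct xs" "x \<notin> set xs \<or> y \<notin> set xs"
  shows "pair_subword x y xs = (if x \<in> set xs then [x] else if y \<in> set xs then [y] else [])"
  using assms by (induction xs) (auto simp: filter_empty_conv)

lemma alternate_iff_distinct_adj: "alternate w x y \<longleftrightarrow> distinct_adj (pair_subword x y w)"
  by (simp add: alternate_def Let_def distinct_adj_conv_nth)

lemma alternate_commute: "alternate w x y \<longleftrightarrow> alternate w y x"
  by (simp add: alternate_def disj_commute)

lemma alternate_factor: "alternate (us @ w @ vs) x y \<Longrightarrow> alternate w x y"
  by (auto simp: alternate_iff_distinct_adj distinct_adj_append_iff)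

lemma alternate_concat:
  assumes "\<And>u. u \<in> set us \<Longrightarrow> pair_subword x y u = [x, y, x, y]" and "x \<noteq> y"
  shows "alternate (concat us) x y"
proof -
  have "distinct_adj (pair_subword x y (concat us)) \<and>
        (us \<noteq> [] \<longrightarrow> hd (pair_subword x y (concat us)) = x)"
    using assms by (induction us) (auto simp: distinct_adj_Cons)
  then show ?thesis by (simp add: alternate_iff_distinct_adj)
qed

lemma word_representable_if_separating_words:
  assumes "finite V" and letters: "\<And>v. v \<in> V \<Longrightarrow> set (u v) = V"
    and adjacent: "\<And>x y. E x y \<Longrightarrow>
      (\<forall>v\<in>V. pair_subword x y (u v) = [x, y, x, y]) \<or> (\<forall>v\<in>V. pair_subword y x (u v) = [y, x, y, x])"
    and separated: "\<And>v y. v \<in> V \<Longrightarrow> v \<noteq> y \<Longrightarrow> \<not> E v y \<Longrightarrow> \<not> alternate (u v) v y"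
  shows "word_representable V E"
proof -
  obtain vs where vs: "set vs = V" using finite_list[OF \<open>finite V\<close>] by blast
  define w where "w = concat (map u vs)"
  have "alternate w x y \<longleftrightarrow> E x y" if "x \<in> V" "x \<noteq> y" for x y
  proof
    assume "alternate w x y"
    obtain vs1 vs2 where "vs = vs1 @ x # vs2" using \<open>x \<in> V\<close> vs by (meson split_list)
    then have "w = concat (map u vs1) @ u x @ concat (map u vs2)" by (simp add: w_def)
    with \<open>alternate w x y\<close> have "alternate (u x) x y" by (metis alternate_factor)
    then show "E x y" using separated that by blast
  next
    assume "E x y"
    have "alternate w s t" if "\<forall>v\<in>V. pair_subword s t (u v) = [s, t, s, t]" "s \<noteq> t" for s t
      unfolding w_def by (rule alternate_concat) (use that vs in auto)
    with adjacent[OF \<open>E x y\<close>] \<open>x \<noteq> y\<close> have "alternate w x y \<or> alternate w y x" by blast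
    then show "alternate w x y" by (simp add: alternate_commute)
  qed
  moreover have "set w = V" using letters vs by (auto simp: w_def)
  ultimately show ?thesis unfolding word_representable_def by blast
qed

text \<open>
  \<open>X\<close>, \<open>Y\<close>, \<open>Z\<close> are the colour classes in cyclic order from that of \<open>v\<close> on. Only neighbours of \<open>v\<close>
  stand between the two letters \<open>v\<close>, so \<open>v\<close> alternates with nothing else, while every \<open>x\<close> in \<open>X\<close>
  leaves the subwords \<open>xyx\<close> and \<open>xzx\<close> with its neighbours.
\<close>

definition separating_block :: "('v \<Rightarrow> 'v \<Rightarrow> bool) \<Rightarrow> 'v list \<Rightarrow> 'v list \<Rightarrow> 'v list \<Rightarrow> 'v \<Rightarrow> 'v list" where
  "separating_block E X Y Z v =
     filter (\<lambda>x. x \<noteq> v) X @ filter (\<lambda>y. \<not> E v y) Y @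
     v # filter (E v) Y @ filter (E v) Z @ v #
     filter (\<lambda>z. \<not> E v z) Z @ filter (\<lambda>x. x \<noteq> v) X"

lemma pair_subword_separating_block:
  assumes "distinct (X @ Y @ Z)" "v \<in> set X"
  shows "x \<in> set X \<Longrightarrow> y \<in> set Y \<union> set Z \<Longrightarrow> E x y \<Longrightarrow>
      pair_subword x y (separating_block E X Y Z v) = [x, y, x]"
    and "y \<in> set Y \<Longrightarrow> z \<in> set Z \<Longrightarrow> pair_subword y z (separating_block E X Y Z v) = [y, z]"
proof -
  have "distinct X" "distinct Y" "distinct Z" and "v \<notin> set Y" "v \<notin> set Z" using assms by auto
  note [simp] = this
  show "pair_subword x y (separating_block E X Y Z v) = [x, y, x]"
    if "x \<in> set X" "y \<in> set Y \<union> set Z" "E x y"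
  proof -
    have "x \<notin> set Y" "x \<notin> set Z" "y \<notin> set X" "y \<in> set Y \<longleftrightarrow> y \<notin> set Z" "v \<noteq> y"
      using that assms by auto
    then show ?thesis using that
      by (cases "x = v") (simp_all add: separating_block_def pair_subword_distinct del: filter_filter)
  qed
  show "pair_subword y z (separating_block E X Y Z v) = [y, z]" if "y \<in> set Y" "z \<in> set Z"
  proof -
    have "y \<notin> set X" "y \<notin> set Z" "z \<notin> set X" "z \<notin> set Y" "y \<noteq> v" "z \<noteq> v"
      using that assms by auto
    then show ?thesis using that
      by (simp add: separating_block_def pair_subword_distinct del: filter_filter)
  qed
qed

lemma not_alternate_separating_block:
  assumes "v \<noteq> y" "\<not> E v v" "\<not> E v y"
  shows "\<not> alternate (separating_block E X Y Z v) v y"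
proof
  let ?u = "v # filter (E v) Y @ filter (E v) Z @ [v]"
  assume "alternate (separating_block E X Y Z v) v y"
  then have "alternate ?u v y"
    using alternate_factor[of "filter (\<lambda>x. x \<noteq> v) X @ filter (\<lambda>y. \<not> E v y) Y" ?u]
    by (simp add: separating_block_def)
  moreover have "pair_subword v y ?u = [v, v]" using assms by (auto simp: filter_empty_conv)
  ultimately show False by (simp add: alternate_iff_distinct_adj del: filter.simps)
qed

definition colour_word :: "('v \<Rightarrow> 'v \<Rightarrow> bool) \<Rightarrow> 'v list \<Rightarrow> 'v list \<Rightarrow> 'v list \<Rightarrow> 'v \<Rightarrow> 'v list" where
  "colour_word E A B C v =
     (if v \<in> set A then separating_block E A B C v @ B @ C
      else if v \<in> set B then A @ separating_block E B C A v @ C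
      else A @ B @ separating_block E C A B v)"

lemma set_colour_word:
  assumes "v \<in> set (A @ B @ C)"
  shows "set (colour_word E A B C v) = set (A @ B @ C)"
  using assms by (auto simp: colour_word_def separating_block_def)

lemma not_alternate_colour_word:
  assumes "v \<noteq> y" "\<not> E v v" "\<not> E v y"
  shows "\<not> alternate (colour_word E A B C v) v y"
proof
  assume "alternate (colour_word E A B C v) v y"
  then have "alternate (separating_block E A B C v) v y \<or> alternate (separating_block E B C A v) v y \<or>
      alternate (separating_block E C A B v) v y"
    using alternate_factor[of "[]" "separating_block E A B C v" "B @ C" v y]
      alternate_factor[of A "separating_block E B C A v" C v y]
      alternate_factor[of "A @ B" "separating_block E C A B v" "[]" v y]
    by (simp add: colour_word_def split: if_splits)
  then show False using not_alternate_separating_block[of v y E] assms by blast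
qed

lemma pair_subword_colour_word:
  assumes dist: "distinct (A @ B @ C)" and v: "v \<in> set (A @ B @ C)"
    and edge: "E x y" "E y x" and xy: "x \<in> set A \<and> y \<in> set B \<union> set C \<or> x \<in> set B \<and> y \<in> set C"
  shows "pair_subword x y (colour_word E A B C v) = [x, y, x, y]"
proof -
  have distincts: "distinct A" "distinct B" "distinct C" using dist by auto
  have membership: "x \<in> set A \<and> x \<notin> set B \<and> x \<notin> set C \<and> y \<notin> set A \<and> (y \<in> set B \<longleftrightarrow> y \<notin> set C) \<or>
      x \<notin> set A \<and> x \<in> set B \<and> x \<notin> set C \<and> y \<notin> set A \<and> y \<notin> set B \<and> y \<in> set C"
    using xy dist by auto
  consider (A) "v \<in> set A" | (B) "v \<in> set B" "v \<notin> set A" | (C) "v \<in> set C" "v \<notin> set A" "v \<notin> set B"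
    using v by auto
  then show ?thesis
  proof cases
    case A
    note block = pair_subword_separating_block[OF dist A]
    show ?thesis using A edge membership
      by (auto simp: colour_word_def pair_subword_distinct distincts block
          block[THEN trans[OF pair_subword_commute]])
  next
    case B
    have "distinct (B @ C @ A)" using dist by auto
    note block = pair_subword_separating_block[OF this B(1)]
    show ?thesis using B edge membership
      by (auto simp: colour_word_def pair_subword_distinct distincts block
          block[THEN trans[OF pair_subword_commute]])
  next
    case C
    have "distinct (C @ A @ B)" using dist by auto
    note block = pair_subword_separating_block[OF this C(1)]
    show ?thesis using C edge membership
      by (auto simp: colour_word_def pair_subword_distinct distincts block
          block[THEN trans[OF pair_subword_commute]])
  qed
qed

lemma three_colourable_imp_word_representable:
  fixes V :: "'v set"
  assumes graph: "simple_graph V E" and "three_colourable V E"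
  shows "word_representable V E"
proof -
  obtain c :: "'v \<Rightarrow> nat" where c_less: "\<And>v. v \<in> V \<Longrightarrow> c v < 3"
    and c_proper: "\<And>x y. E x y \<Longrightarrow> c x \<noteq> c y"
    using assms simple_graph_in_vertices unfolding three_colourable_def by metis
  obtain vs where vs: "set vs = V" "distinct vs"
    using finite_distinct_list[OF simple_graph_finite[OF graph]] by blast
  define colour_class where "colour_class i = filter (\<lambda>v. c v = i) vs" for i
  let ?A = "colour_class 0" and ?B = "colour_class 1" and ?C = "colour_class 2"
  have mem_class: "v \<in> set (colour_class i) \<longleftrightarrow> v \<in> V \<and> c v = i" for v i
    using vs by (auto simp: colour_class_def)
  have classes: "distinct (?A @ ?B @ ?C)" using vs by (auto simp: colour_class_def)
  have V: "set (?A @ ?B @ ?C) = V" using c_less by (force simp: mem_class)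
  have ordered: "pair_subword x y (colour_word E ?A ?B ?C v) = [x, y, x, y]"
    if "E x y" "c x < c y" "v \<in> V" for x y v
  proof (rule pair_subword_colour_word[OF classes])
    have "c y < 3" "x \<in> V" "y \<in> V" using c_less simple_graph_in_vertices[OF graph \<open>E x y\<close>] by auto
    then show "x \<in> set ?A \<and> y \<in> set ?B \<union> set ?C \<or> x \<in> set ?B \<and> y \<in> set ?C"
      using \<open>c x < c y\<close> by (auto simp: mem_class)
    show "v \<in> set (?A @ ?B @ ?C)" using V \<open>v \<in> V\<close> by blast
  qed (use \<open>E x y\<close> simple_graph_sym[OF graph] in blast)+
  show ?thesis
  proof (rule word_representable_if_separating_words[of V "colour_word E ?A ?B ?C"])
    show "finite V" using graph by (rule simple_graph_finite)
    show "set (colour_word E ?A ?B ?C v) = V" if "v \<in> V" for v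
      using that V set_colour_word[of v ?A ?B ?C] by simp
    show "(\<forall>v\<in>V. pair_subword x y (colour_word E ?A ?B ?C v) = [x, y, x, y]) \<or>
        (\<forall>v\<in>V. pair_subword y x (colour_word E ?A ?B ?C v) = [y, x, y, x])" if "E x y" for x y
      using c_proper[OF that] ordered[OF that] ordered[OF simple_graph_sym[OF graph that]]
      by (cases "c x < c y") simp_all
    show "\<not> alternate (colour_word E ?A ?B ?C v) v y" if "v \<noteq> y" "\<not> E v y" for v y
      using not_alternate_colour_word[of v y E] that simple_graph_irrefl[OF graph] by blast
  qed
qed

section \<open>Neighbourhoods in word-representable graphs\<close>

definition leads :: "'v list \<Rightarrow> 'v \<Rightarrow> 'v \<Rightarrow> bool" where
  "leads w x y \<longleftrightarrow> (\<forall>n. count_list (take n w) y \<le> count_list (take n w) x \<and>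
     count_list (take n w) x \<le> Suc (count_list (take n w) y))"

lemma leads_Nil: "leads [] x y"
  by (simp add: leads_def)

lemma leads_Cons:
  assumes "x \<noteq> y"
  shows "leads (z # w) x y \<longleftrightarrow> (if z = x then leads w y x else z \<noteq> y \<and> leads w x y)"
proof -
  have all_nat: "(\<forall>n. P n) \<longleftrightarrow> P 0 \<and> (\<forall>n. P (Suc n))" for P :: "nat \<Rightarrow> bool"
    using not0_implies_Suc by metis
  have shift: "leads (z # w) x y \<longleftrightarrow> (\<forall>n. count_list (z # take n w) y \<le> count_list (z # take n w) x \<and>
      count_list (z # take n w) x \<le> Suc (count_list (z # take n w) y))"
    unfolding leads_def by (subst all_nat) simp
  show ?thesis using assms unfolding shift leads_def[of w]
    by (cases "z = x"; cases "z = y") (auto intro: exI[of _ 0])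
qed

lemma distinct_adj_pair_subword_Cons:
  "x \<noteq> y \<Longrightarrow> distinct_adj (y # pair_subword x y w) \<longleftrightarrow> leads w x y"
proof (induction w arbitrary: x y)
  case Nil
  then show ?case by (simp add: leads_Nil)
next
  case (Cons z w)
  have "distinct_adj (x # pair_subword x y w) \<longleftrightarrow> leads w y x"
    using Cons.IH[of y x] Cons.prems by (simp add: disj_commute)
  then show ?case using Cons by (auto simp: leads_Cons)
qed

lemma alternate_iff_leads:
  assumes "x \<noteq> y"
  shows "alternate w x y \<longleftrightarrow> leads w x y \<or> leads w y x"
proof -
  have "alternate w x y \<longleftrightarrow>
      distinct_adj (y # pair_subword x y w) \<or> distinct_adj (x # pair_subword x y w)"
  proof (cases "pair_subword x y w")
    case (Cons z zs)
    then have "z = x \<or> z = y" by (auto dest!: filter_eq_ConsD)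
    then show ?thesis using assms Cons by (auto simp: alternate_iff_distinct_adj)
  qed (simp add: alternate_iff_distinct_adj)
  then show ?thesis
    using assms distinct_adj_pair_subword_Cons[of x y w] distinct_adj_pair_subword_Cons[of y x w]
    by (simp add: pair_subword_commute[of y x])
qed

text \<open>
  Letters that alternate with \<open>v\<close> are counted only from the first \<open>v\<close> on. Comparing these counts
  pointwise expresses the cyclic order in which \<open>v\<close> and two such letters recur.
\<close>

definition level :: "'v list \<Rightarrow> 'v \<Rightarrow> 'v \<Rightarrow> nat \<Rightarrow> int" where
  "level w v x n = int (count_list (take n w) x) - of_bool (leads w x v)"

lemma level_bounds:
  assumes "alternate w v x" "v \<noteq> x"
  shows "int (count_list (take n w) v) - 1 \<le> level w v x n"
    and "level w v x n \<le> int (count_list (take n w) v)"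
proof -
  let ?v = "count_list (take n w) v" and ?x = "count_list (take n w) x"
  have "leads w x v \<and> ?v \<le> ?x \<and> ?x \<le> Suc ?v \<or> \<not> leads w x v \<and> ?x \<le> ?v \<and> ?v \<le> Suc ?x"
    using assms alternate_iff_leads[of v x w] unfolding leads_def by blast
  then show "int ?v - 1 \<le> level w v x n" "level w v x n \<le> int ?v"
    by (auto simp: level_def)
qed

lemma level_eq_imp_eq:
  assumes "x \<in> set w" "level w v x = level w v y"
  shows "x = y"
proof (rule ccontr)
  assume "x \<noteq> y"
  obtain us vs where w: "w = us @ x # vs" using \<open>x \<in> set w\<close> by (meson split_list)
  have "level w v x (length us) = level w v y (length us)"
    "level w v x (Suc (length us)) = level w v y (Suc (length us))"
    using assms(2) by simp_all
  then show False using \<open>x \<noteq> y\<close> by (simp add: level_def w)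
qed

lemma level_comparable_if_leads:
  assumes "leads w x y"
  shows "level w v x \<le> level w v y \<or> level w v y \<le> level w v x"
proof -
  have counts: "count_list (take n w) y \<le> count_list (take n w) x"
    "count_list (take n w) x \<le> Suc (count_list (take n w) y)" for n
    using assms by (simp_all add: leads_def)
  show ?thesis
  proof (cases "leads w x v \<and> \<not> leads w y v")
    case True
    then have "level w v x n \<le> level w v y n" for n using counts(2)[of n] by (simp add: level_def)
    then show ?thesis by (simp add: le_fun_def)
  next
    case False
    then have "level w v y n \<le> level w v x n" for n using counts(1)[of n] by (auto simp: level_def)
    then show ?thesis by (simp add: le_fun_def)
  qed
qed

lemma leads_if_level_le:
  assumes x: "alternate w v x" "v \<noteq> x" and y: "alternate w v y" "v \<noteq> y"
    and "level w v x \<le> level w v y"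
  shows "leads w x y \<or> leads w y x"
proof -
  have levels: "level w v x n \<le> level w v y n" "level w v y n \<le> level w v x n + 1" for n
    using assms(5) level_bounds[OF x, of n] level_bounds[OF y, of n] by (simp_all add: le_fun_def)
  have "leads w x v" if "leads w y v"
    using levels(1)[of 0] that by (simp add: level_def of_bool_def split: if_splits)
  then consider (different) "leads w x v" "\<not> leads w y v" | (same) "leads w x v \<longleftrightarrow> leads w y v" by blast
  then show ?thesis
  proof cases
    case different
    have "count_list (take n w) y \<le> count_list (take n w) x \<and>
        count_list (take n w) x \<le> Suc (count_list (take n w) y)" for n
      using different levels[of n] by (simp add: level_def)
    then show ?thesis by (simp add: leads_def)
  next
    case same
    have "count_list (take n w) x \<le> count_list (take n w) y \<and>
        count_list (take n w) y \<le> Suc (count_list (take n w) x)" for n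
      using same levels[of n] by (simp add: level_def)
    then show ?thesis by (simp add: leads_def)
  qed
qed

lemma alternate_iff_level_comparable:
  assumes "alternate w v x" "v \<noteq> x" "alternate w v y" "v \<noteq> y" "x \<noteq> y"
  shows "alternate w x y \<longleftrightarrow> level w v x \<le> level w v y \<or> level w v y \<le> level w v x"
  unfolding alternate_iff_leads[OF assms(5)]
  using level_comparable_if_leads[of w x y v] level_comparable_if_leads[of w y x v]
    leads_if_level_le[OF assms(1-4)] leads_if_level_le[OF assms(3,4,1,2)] by blast

definition local_two_colouring :: "('v \<Rightarrow> 'v \<Rightarrow> bool) \<Rightarrow> ('v \<Rightarrow> 'v \<Rightarrow> bool) \<Rightarrow> bool" where
  "local_two_colouring E b \<longleftrightarrow> (\<forall>v x y. E v x \<longrightarrow> E v y \<longrightarrow> E x y \<longrightarrow> b v x \<noteq> b v y)"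

definition local_comparability :: "('v \<Rightarrow> 'v \<Rightarrow> bool) \<Rightarrow> ('v \<Rightarrow> 'v \<Rightarrow> 'a::order) \<Rightarrow> bool" where
  "local_comparability E l \<longleftrightarrow> (\<forall>v x y. E v x \<longrightarrow> E v y \<longrightarrow> x \<noteq> y \<longrightarrow>
     l v x \<noteq> l v y \<and> (E x y \<longleftrightarrow> l v x \<le> l v y \<or> l v y \<le> l v x))"

lemma word_representable_imp_local_comparability:
  fixes V :: "'v set"
  assumes graph: "simple_graph V E" and "word_representable V E"
  shows "\<exists>l :: 'v \<Rightarrow> 'v \<Rightarrow> nat \<Rightarrow> int. local_comparability E l"
proof -
  obtain w where w: "set w = V"
    and represents: "\<And>x y. x \<in> V \<Longrightarrow> y \<in> V \<Longrightarrow> x \<noteq> y \<Longrightarrow> alternate w x y \<longleftrightarrow> E x y"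
    using assms(2) unfolding word_representable_def by blast
  have "level w v x \<noteq> level w v y \<and> (E x y \<longleftrightarrow> level w v x \<le> level w v y \<or> level w v y \<le> level w v x)"
    if "E v x" "E v y" "x \<noteq> y" for v x y
  proof
    have in_V: "v \<in> V" "x \<in> V" "y \<in> V" and ne: "v \<noteq> x" "v \<noteq> y"
      using that simple_graph_in_vertices[OF graph] simple_graph_irrefl[OF graph, of v] by auto
    show "level w v x \<noteq> level w v y" using level_eq_imp_eq[of x w v y] w in_V(2) \<open>x \<noteq> y\<close> by blast
    have "alternate w v x" "alternate w v y" using that in_V ne by (simp_all add: represents)
    from alternate_iff_level_comparable[OF this(1) ne(1) this(2) ne(2) \<open>x \<noteq> y\<close>]
    show "E x y \<longleftrightarrow> level w v x \<le> level w v y \<or> level w v y \<le> level w v x"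
      using represents[OF in_V(2,3) \<open>x \<noteq> y\<close>] by blast
  qed
  then have "local_comparability E (level w)" unfolding local_comparability_def by blast
  then show ?thesis by blast
qed

lemma local_comparability_imp_local_two_colouring:
  assumes graph: "simple_graph V E" and K4: "\<not> has_induced_K4 V E"
    and l: "local_comparability E l"
  shows "local_two_colouring E (\<lambda>v x. \<exists>y. E v y \<and> l v y < l v x)"
proof -
  note in_V = simple_graph_in_vertices[OF graph] and irrefl = simple_graph_irrefl[OF graph]
  have adjacent_iff: "E x y \<longleftrightarrow> l v x < l v y \<or> l v y < l v x" if "E v x" "E v y" for v x y
  proof (cases "x = y")
    case True
    then show ?thesis using irrefl by simp
  next
    case False
    have "l v x \<noteq> l v y" "E x y \<longleftrightarrow> l v x \<le> l v y \<or> l v y \<le> l v x"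
      using l that False unfolding local_comparability_def by blast+
    then show ?thesis unfolding order_less_le by metis
  qed
  have no_chain: False
    if "E v x" "E v y" "E v z" and less: "l v x < l v y" "l v y < l v z" for v x y z
  proof -
    have "l v x < l v z" using less by (rule less_trans)
    then have "E x y" "E y z" "E x z"
      using adjacent_iff[of v x y] adjacent_iff[of v y z] adjacent_iff[of v x z] that by blast+
    moreover from this have "distinct [v, x, y, z]" using that(1-3) by (auto simp: irrefl)
    ultimately show False using K4 that(1-3) in_V[of v x] in_V[of v y] in_V[of v z]
      unfolding has_induced_K4_def by blast
  qed
  show ?thesis
    unfolding local_two_colouring_def
  proof (intro allI impI)
    fix v x y assume edges: "E v x" "E v y" "E x y"
    then have "l v x < l v y \<or> l v y < l v x" using adjacent_iff by blast
    then show "(\<exists>z. E v z \<and> l v z < l v x) \<noteq> (\<exists>z. E v z \<and> l v z < l v y)"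
      using edges no_chain[of v _ x y] no_chain[of v _ y x] by blast
  qed
qed

section \<open>Cycles and potentials\<close>

fun walk_edges :: "'v list \<Rightarrow> ('v \<times> 'v) set" where
  "walk_edges (x # y # zs) = insert (x, y) (walk_edges (y # zs))"
| "walk_edges _ = {}"

fun walk_sum :: "('v \<Rightarrow> 'v \<Rightarrow> 'a::ab_group_add) \<Rightarrow> 'v list \<Rightarrow> 'a" where
  "walk_sum g (x # y # zs) = g x y + walk_sum g (y # zs)"
| "walk_sum g _ = 0"

definition graph_cycle :: "('v \<Rightarrow> 'v \<Rightarrow> bool) \<Rightarrow> 'v list \<Rightarrow> bool" where
  "graph_cycle E xs \<longleftrightarrow> distinct xs \<and> 3 \<le> length xs \<and> successively E xs \<and> E (last xs) (hd xs)"

definition cycle_edges :: "'v list \<Rightarrow> ('v \<times> 'v) set" where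
  "cycle_edges xs = insert (last xs, hd xs) (walk_edges xs)"

definition cycle_sum :: "('v \<Rightarrow> 'v \<Rightarrow> 'a::ab_group_add) \<Rightarrow> 'v list \<Rightarrow> 'a" where
  "cycle_sum g xs = walk_sum g xs + g (last xs) (hd xs)"

definition edge_cochain :: "('v \<Rightarrow> 'v \<Rightarrow> bool) \<Rightarrow> ('v \<Rightarrow> 'v \<Rightarrow> 'a::ab_group_add) \<Rightarrow> bool" where
  "edge_cochain E g \<longleftrightarrow> (\<forall>x y. E x y \<longrightarrow> g y x = - g x y)"

definition edge_coboundary :: "('v \<Rightarrow> 'v \<Rightarrow> bool) \<Rightarrow> ('v \<Rightarrow> 'v \<Rightarrow> 'a::ab_group_add) \<Rightarrow> bool" where
  "edge_coboundary E g \<longleftrightarrow> (\<exists>f. \<forall>x y. E x y \<longrightarrow> g x y = f y - f x)"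

definition edge_cocycle :: "('v \<Rightarrow> 'v \<Rightarrow> bool) \<Rightarrow> ('v \<Rightarrow> 'v \<Rightarrow> 'a::ab_group_add) \<Rightarrow> bool" where
  "edge_cocycle E g \<longleftrightarrow> edge_cochain E g \<and>
     (\<forall>x y z. E x y \<longrightarrow> E y z \<longrightarrow> E z x \<longrightarrow> g x y + g y z + g z x = 0)"

definition remove_edge :: "('v \<Rightarrow> 'v \<Rightarrow> bool) \<Rightarrow> 'v \<Rightarrow> 'v \<Rightarrow> 'v \<Rightarrow> 'v \<Rightarrow> bool" where
  "remove_edge E a b x y \<longleftrightarrow> E x y \<and> {x, y} \<noteq> {a, b}"

lemma edge_cochainD: "edge_cochain E g \<Longrightarrow> E x y \<Longrightarrow> g y x = - g x y"
  by (simp add: edge_cochain_def)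

lemma walk_edges_append:
  "walk_edges (xs @ y # ys) = walk_edges (xs @ [y]) \<union> walk_edges (y # ys)"
  by (induction xs rule: walk_edges.induct) auto

lemma walk_sum_append:
  "walk_sum g (xs @ y # ys) = walk_sum g (xs @ [y]) + walk_sum g (y # ys)"
  by (induction xs rule: walk_edges.induct) (auto simp: algebra_simps)

lemma walk_edges_snoc: "xs \<noteq> [] \<Longrightarrow> walk_edges (xs @ [y]) = insert (last xs, y) (walk_edges xs)"
  by (induction xs rule: walk_edges.induct) auto

lemma walk_sum_snoc: "xs \<noteq> [] \<Longrightarrow> walk_sum g (xs @ [y]) = walk_sum g xs + g (last xs) y"
  by (induction xs rule: walk_edges.induct) (auto simp: algebra_simps)

lemma walk_edges_decomp: "(u, v) \<in> walk_edges xs \<Longrightarrow> \<exists>ys zs. xs = ys @ u # v # zs"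
proof (induction xs rule: walk_edges.induct)
  case (1 x y zs)
  then consider (head) "(u, v) = (x, y)" | (tail) "(u, v) \<in> walk_edges (y # zs)" by auto
  then show ?case
  proof cases
    case head
    then show ?thesis by (intro exI[of _ "[]"] exI[of _ zs]) simp
  next
    case tail
    with 1 obtain us vs where "y # zs = us @ u # v # vs" by blast
    then show ?thesis by (intro exI[of _ "x # us"] exI[of _ vs]) simp
  qed
qed auto

lemma walk_edges_in_set: "(u, v) \<in> walk_edges xs \<Longrightarrow> u \<in> set xs \<and> v \<in> set xs"
  by (auto dest: walk_edges_decomp)

lemma walk_edges_successively: "successively E xs \<Longrightarrow> (u, v) \<in> walk_edges xs \<Longrightarrow> E u v"
  by (induction xs rule: walk_edges.induct) auto

lemma walk_edges_not_closing:
  assumes "distinct xs" "3 \<le> length xs" "(u, v) \<in> walk_edges xs"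
  shows "{u, v} \<noteq> {last xs, hd xs}"
proof -
  obtain ys zs where "xs = ys @ u # v # zs" using walk_edges_decomp[OF assms(3)] by blast
  then show ?thesis
    using assms by (cases ys; cases zs rule: rev_cases) (auto simp: doubleton_eq_iff)
qed

lemma cycle_edges_edge: "graph_cycle E xs \<Longrightarrow> (u, v) \<in> cycle_edges xs \<Longrightarrow> E u v"
  unfolding cycle_edges_def graph_cycle_def using walk_edges_successively by fastforce

lemma graph_cycle_if_cycle_sum_nonzero:
  assumes cochain: "edge_cochain E g" and irrefl: "\<And>x. \<not> E x x"
    and xs: "xs \<noteq> []" "distinct xs" "successively E xs" "E (last xs) (hd xs)"
    and "cycle_sum g xs \<noteq> 0"
  shows "graph_cycle E xs"
proof -
  consider (loop) a where "xs = [a]" | (back_and_forth) a b where "xs = [a, b]" | (long) "3 \<le> length xs"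
    using \<open>xs \<noteq> []\<close> by (cases xs; cases "tl xs"; cases "tl (tl xs)") auto
  then show ?thesis
  proof cases
    case loop
    then show ?thesis using xs irrefl by simp
  next
    case (back_and_forth a b)
    then have "cycle_sum g xs = 0"
      using xs edge_cochainD[OF cochain, of a b] by (simp add: cycle_sum_def)
    then show ?thesis using assms by blast
  next
    case long
    then show ?thesis using xs by (simp add: graph_cycle_def)
  qed
qed

lemma graph_cycle_split_chord:
  assumes cochain: "edge_cochain E g" and irrefl: "\<And>x. \<not> E x x"
    and xs: "graph_cycle E (us @ d # vs)" "us \<noteq> []" "vs \<noteq> []" "cycle_sum g (us @ d # vs) \<noteq> 0"
    and d: "E (last vs) d" "E d (hd us)" "g (last vs) (hd us) = g (last vs) d + g d (hd us)"
  shows "\<exists>ys. graph_cycle E ys \<and> cycle_sum g ys \<noteq> 0 \<and>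
    cycle_edges ys \<subseteq> walk_edges (us @ d # vs) \<union> {(last vs, d), (d, hd us)}"
proof -
  note is_cycle = graph_cycle_if_cycle_sum_nonzero[OF cochain irrefl]
  have walk: "distinct (us @ d # vs)" "successively E (us @ d # vs)"
    using xs(1) by (auto simp: graph_cycle_def)
  have "cycle_sum g (us @ d # vs) = cycle_sum g (us @ [d]) + cycle_sum g (d # vs)"
    using xs(2,3) d(3) walk_sum_append[of g us d vs] by (simp add: cycle_sum_def algebra_simps)
  then consider (left) "cycle_sum g (us @ [d]) \<noteq> 0" | (right) "cycle_sum g (d # vs) \<noteq> 0" using xs(4) by force
  then show ?thesis
  proof cases
    case left
    have "cycle_edges (us @ [d]) \<subseteq> walk_edges (us @ d # vs) \<union> {(last vs, d), (d, hd us)}"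
      using xs(2) walk_edges_append[of us d vs] by (auto simp: cycle_edges_def)
    moreover have "graph_cycle E (us @ [d])"
      using is_cycle[OF _ _ _ _ left] walk d xs(2) by (simp add: successively_append_iff)
    ultimately show ?thesis using left by blast
  next
    case right
    have "cycle_edges (d # vs) \<subseteq> walk_edges (us @ d # vs) \<union> {(last vs, d), (d, hd us)}"
      using xs(3) walk_edges_append[of us d vs] by (auto simp: cycle_edges_def)
    moreover have "graph_cycle E (d # vs)"
      using is_cycle[OF _ _ _ _ right] walk d xs(3) by (simp add: successively_append_iff)
    ultimately show ?thesis using right by blast
  qed
qed

lemma graph_cycle_across_triangle:
  assumes cochain: "edge_cochain E g" and irrefl: "\<And>x. \<not> E x x"
    and xs: "graph_cycle E xs" "cycle_sum g xs \<noteq> 0"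
    and d: "E (last xs) d" "E d (hd xs)" "g (last xs) (hd xs) = g (last xs) d + g d (hd xs)"
  shows "\<exists>ys. graph_cycle E ys \<and> cycle_sum g ys \<noteq> 0 \<and>
    cycle_edges ys \<subseteq> walk_edges xs \<union> {(last xs, d), (d, hd xs)}"
proof (cases "d \<in> set xs")
  case True
  then obtain us vs where split: "xs = us @ d # vs" by (meson split_list)
  have "d \<noteq> hd xs" "d \<noteq> last xs" using d irrefl by auto
  then have "us \<noteq> []" "vs \<noteq> []" "hd xs = hd us" "last xs = last vs"
    using split by (auto simp: hd_append split: if_splits)
  then show ?thesis
    using graph_cycle_split_chord[OF cochain irrefl, of us d vs] xs d by (simp add: split)
next
  case False
  have walk: "distinct xs" "successively E xs" and "xs \<noteq> []"
    using xs(1) by (auto simp: graph_cycle_def)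
  have sum: "cycle_sum g (xs @ [d]) \<noteq> 0"
    using xs(2) d(3) \<open>xs \<noteq> []\<close> by (simp add: cycle_sum_def walk_sum_snoc add.assoc)
  have "cycle_edges (xs @ [d]) \<subseteq> walk_edges xs \<union> {(last xs, d), (d, hd xs)}"
    using \<open>xs \<noteq> []\<close> by (auto simp: cycle_edges_def walk_edges_snoc)
  moreover have "graph_cycle E (xs @ [d])"
    using graph_cycle_if_cycle_sum_nonzero[OF cochain irrefl _ _ _ _ sum] False walk d \<open>xs \<noteq> []\<close>
    by (simp add: successively_append_iff)
  ultimately show ?thesis using sum by blast
qed

lemma rtranclp_imp_distinct_walk:
  assumes "E\<^sup>*\<^sup>* x y"
  obtains xs where "distinct (x # xs)" "successively E (x # xs)" "last (x # xs) = y"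
proof -
  have walk: "successively E (x # xs) \<and> last (x # xs) = y" if "rtrancl_path E x xs y" for xs
    using that by induction (auto simp: successively_Cons)
  obtain xs where "rtrancl_path E x xs y" "distinct (x # xs)"
    using assms rtrancl_path_distinct unfolding rtranclp_eq_rtrancl_path by metis
  then show thesis using that walk by blast
qed

lemma walk_sum_potential:
  assumes "\<And>x y. E x y \<Longrightarrow> g x y = f y - f x"
  shows "successively E (x # xs) \<Longrightarrow> walk_sum g (x # xs) = f (last (x # xs)) - f x"
  by (induction xs arbitrary: x) (auto simp: assms)

lemma edge_coboundary_if_potential_remove_edge:
  assumes "edge_cochain E g" "E a b" "g a b = f b - f a"
    and f: "\<And>x y. remove_edge E a b x y \<Longrightarrow> g x y = f y - f x"
  shows "edge_coboundary E g"
proof -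
  have "g x y = f y - f x" if "E x y" for x y
  proof -
    consider "remove_edge E a b x y" | "x = a" "y = b" | "x = b" "y = a"
      using \<open>E x y\<close> by (auto simp: remove_edge_def doubleton_eq_iff)
    then show ?thesis using f edge_cochainD[OF assms(1,2)] assms(3) by cases simp_all
  qed
  then show ?thesis unfolding edge_coboundary_def by blast
qed

lemma edge_coboundary_if_remove_edge:
  assumes graph: "simple_graph V E" and ab: "E a b" and cochain: "edge_cochain E g"
    and cycles: "\<And>xs. graph_cycle E xs \<Longrightarrow> cycle_sum g xs = 0"
    and f: "\<And>x y. remove_edge E a b x y \<Longrightarrow> g x y = f y - f x"
  shows "edge_coboundary E g"
proof (cases "(remove_edge E a b)\<^sup>*\<^sup>* b a")
  let ?E' = "remove_edge E a b"
  case True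
  then obtain xs where xs: "distinct (b # xs)" "successively ?E' (b # xs)" "last (b # xs) = a"
    by (rule rtranclp_imp_distinct_walk)
  have sum: "walk_sum g (b # xs) = f a - f b" using walk_sum_potential[OF f xs(2)] xs(3) by simp
  have "graph_cycle E (b # xs)" if "cycle_sum g (b # xs) \<noteq> 0"
  proof (rule graph_cycle_if_cycle_sum_nonzero[OF cochain _ _ xs(1) _ _ that])
    show "successively E (b # xs)"
      using xs(2) by (rule successively_mono) (simp_all add: remove_edge_def)
  qed (use ab xs(3) simple_graph_irrefl[OF graph] in auto)
  then have "cycle_sum g (b # xs) = 0" using cycles by blast
  then have "g a b = f b - f a" using sum xs(3) by (simp add: cycle_sum_def algebra_simps)
  with cochain ab show ?thesis using f by (rule edge_coboundary_if_potential_remove_edge)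
next
  let ?E' = "remove_edge E a b"
  case False
  define f' where "f' x = f x + (if ?E'\<^sup>*\<^sup>* b x then g a b - f b + f a else 0)" for x
  have "?E'\<^sup>*\<^sup>* b x \<longleftrightarrow> ?E'\<^sup>*\<^sup>* b y" if "?E' x y" for x y
  proof -
    have "?E' y x" using that simple_graph_sym[OF graph] by (simp add: remove_edge_def insert_commute)
    then show ?thesis using that by (meson rtranclp.rtrancl_into_rtrancl)
  qed
  then have "g x y = f' y - f' x" if "?E' x y" for x y
    using f[OF that] that by (simp add: f'_def)
  moreover have "g a b = f' b - f' a" using False by (simp add: f'_def)
  ultimately show ?thesis using edge_coboundary_if_potential_remove_edge[OF cochain ab] by blast
qed

lemma edge_coboundary_if_cycle_sums_0:
  fixes g :: "'v \<Rightarrow> 'v \<Rightarrow> 'a::ab_group_add"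
  assumes "simple_graph V E" and "edge_cochain E g"
    and "\<And>xs. graph_cycle E xs \<Longrightarrow> cycle_sum g xs = 0"
  shows "edge_coboundary E g"
  using assms
proof (induction "card {(x, y). E x y}" arbitrary: E rule: less_induct)
  case less
  note graph = less.prems(1)
  show ?case
  proof (cases "\<exists>a b. E a b")
    case True
    then obtain a b where ab: "E a b" by blast
    let ?E' = "remove_edge E a b"
    have "{(x, y). E x y} \<subseteq> V \<times> V" using simple_graph_in_vertices[OF graph] by auto
    then have "finite {(x, y). E x y}"
      using simple_graph_finite[OF graph] finite_subset by blast
    moreover have "{(x, y). ?E' x y} \<subset> {(x, y). E x y}" using ab by (auto simp: remove_edge_def)
    ultimately have fewer_edges: "card {(x, y). ?E' x y} < card {(x, y). E x y}"
      by (rule psubset_card_mono)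
    have "edge_coboundary ?E' g"
    proof (rule less.hyps[OF fewer_edges])
      show "simple_graph V ?E'"
        using graph by (auto simp: simple_graph_def remove_edge_def insert_commute)
      show "edge_cochain ?E' g"
        using less.prems(2) by (simp add: edge_cochain_def remove_edge_def)
      fix xs assume cycle: "graph_cycle ?E' xs"
      then have "successively ?E' xs" by (simp add: graph_cycle_def)
      then have "successively E xs" by (rule successively_mono) (simp_all add: remove_edge_def)
      then have "graph_cycle E xs" using cycle by (simp add: graph_cycle_def remove_edge_def)
      then show "cycle_sum g xs = 0" by (rule less.prems(3))
    qed
    then obtain f where f: "\<And>x y. ?E' x y \<Longrightarrow> g x y = f y - f x"
      unfolding edge_coboundary_def by blast
    show ?thesis
      using graph ab less.prems(2,3) f by (rule edge_coboundary_if_remove_edge)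
  qed (simp add: edge_coboundary_def)
qed

section \<open>Cycles in plane graphs\<close>

lemma inside_subset_inside_curve:
  fixes c :: "real \<Rightarrow> complex"
  assumes c: "simple_path c" "pathfinish c = pathstart c"
    and S: "open (inside S)" "S \<subseteq> path_image c \<union> inside (path_image c)"
  shows "inside S \<subseteq> inside (path_image c)"
proof -
  let ?C = "path_image c"
  have outside: "connected (outside ?C)" "\<not> bounded (outside ?C)" "frontier (outside ?C) = ?C"
    using Jordan_inside_outside[OF c] by simp_all
  have "S \<inter> outside ?C = {}"
    using S(2) inside_Int_outside[of ?C] outside_no_overlap[of ?C] by blast
  then have "(- outside ?C - S) \<union> outside ?C = - S" by blast
  with outside(1,2) have "inside S \<subseteq> - outside ?C - S" by (rule inside_subset)
  then have disjoint: "inside S \<inter> outside ?C = {}" by blast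
  then have "inside S \<inter> closure (outside ?C) = {}"
    using S(1) by (simp add: open_Int_closure_eq_empty)
  moreover have "?C \<subseteq> closure (outside ?C)" using outside(3) unfolding frontier_def by blast
  ultimately have "inside S \<inter> ?C = {}" by blast
  then show ?thesis using disjoint inside_Un_outside[of ?C] by blast
qed

lemma inside_curve_psubset:
  fixes c d :: "real \<Rightarrow> complex"
  assumes c: "simple_path c" "pathfinish c = pathstart c"
    and d: "simple_path d" "pathfinish d = pathstart d"
    and "path_image d \<subseteq> path_image c \<union> inside (path_image c)" "path_image d \<noteq> path_image c"
  shows "inside (path_image d) \<subset> inside (path_image c)"
proof
  show "inside (path_image d) \<subseteq> inside (path_image c)"
  proof (rule inside_subset_inside_curve)
    show "open (inside (path_image d))" using Jordan_inside_outside[OF d] by simp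
  qed (fact assms)+
  have "frontier (inside (path_image c)) = path_image c"
    "frontier (inside (path_image d)) = path_image d"
    using Jordan_inside_outside[OF c] Jordan_inside_outside[OF d] by simp_all
  then show "inside (path_image d) \<noteq> inside (path_image c)" using assms(6) by metis
qed

fun walk_path :: "('v \<Rightarrow> 'v \<Rightarrow> real \<Rightarrow> complex) \<Rightarrow> 'v list \<Rightarrow> real \<Rightarrow> complex" where
  "walk_path \<gamma> [x, y] = \<gamma> x y"
| "walk_path \<gamma> (x # y # z # zs) = \<gamma> x y +++ walk_path \<gamma> (y # z # zs)"
| "walk_path \<gamma> _ = (\<lambda>_. 0)"

definition edge_points :: "('v \<Rightarrow> 'v \<Rightarrow> real \<Rightarrow> complex) \<Rightarrow> ('v \<times> 'v) set \<Rightarrow> complex set" where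
  "edge_points \<gamma> D = (\<Union>(u, v)\<in>D. path_image (\<gamma> u v))"

lemma edge_points_mono: "D \<subseteq> D' \<Longrightarrow> edge_points \<gamma> D \<subseteq> edge_points \<gamma> D'"
  by (auto simp: edge_points_def)

lemma edge_points_subset_drawing:
  assumes "\<And>u v. (u, v) \<in> D \<Longrightarrow> E u v"
  shows "edge_points \<gamma> D \<subseteq> drawing V E p \<gamma>"
  unfolding edge_points_def drawing_def using assms by blast

lemma triangular_face_frontier_pointE:
  assumes "triangular_face V E \<gamma> F" "r \<in> frontier F"
  obtains a b c where "E a b" "E b c" "E c a" "r \<in> path_image (\<gamma> a b)"
    "path_image (\<gamma> b c) \<union> path_image (\<gamma> c a) \<subseteq> frontier F"
proof -
  obtain a b c where triangle: "E a b" "E b c" "E c a"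
    and frontier: "frontier F = path_image (\<gamma> a b) \<union> path_image (\<gamma> b c) \<union> path_image (\<gamma> c a)"
    using assms(1) unfolding triangular_face_def by blast
  consider (ab) "r \<in> path_image (\<gamma> a b)" | (bc) "r \<in> path_image (\<gamma> b c)" | (ca) "r \<in> path_image (\<gamma> c a)"
    using assms(2) frontier by blast
  then show thesis
  proof cases
    case ab
    then show ?thesis by (intro that[of a b c]) (auto simp: triangle frontier)
  next
    case bc
    then show ?thesis by (intro that[of b c a]) (auto simp: triangle frontier)
  next
    case ca
    then show ?thesis by (intro that[of c a b]) (auto simp: triangle frontier)
  qed
qed

locale plane_graph =
  fixes V :: "'v set" and E :: "'v \<Rightarrow> 'v \<Rightarrow> bool"
    and p :: "'v \<Rightarrow> complex" and \<gamma> :: "'v \<Rightarrow> 'v \<Rightarrow> real \<Rightarrow> complex"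
  assumes graph: "simple_graph V E" and embedding: "plane_embedding V E p \<gamma>"
begin

lemmas in_V = simple_graph_in_vertices[OF graph]
  and sym = simple_graph_sym[OF graph]
  and irrefl = simple_graph_irrefl[OF graph]
  and finite_V = simple_graph_finite[OF graph]

lemma arc_edge: "E x y \<Longrightarrow> arc (\<gamma> x y)"
  and start_edge: "E x y \<Longrightarrow> pathstart (\<gamma> x y) = p x"
  and finish_edge: "E x y \<Longrightarrow> pathfinish (\<gamma> x y) = p y"
  and reverse_edge: "E x y \<Longrightarrow> \<gamma> y x = reversepath (\<gamma> x y)"
  and edges_meet: "E x y \<Longrightarrow> E u v \<Longrightarrow> {x, y} \<noteq> {u, v} \<Longrightarrow>
        path_image (\<gamma> x y) \<inter> path_image (\<gamma> u v) \<subseteq> p ` ({x, y} \<inter> {u, v})"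
  and vertex_off_edge: "E x y \<Longrightarrow> z \<in> V \<Longrightarrow> z \<noteq> x \<Longrightarrow> z \<noteq> y \<Longrightarrow> p z \<notin> path_image (\<gamma> x y)"
  using embedding unfolding plane_embedding_def by blast+

lemma path_image_edge_commute: "E x y \<Longrightarrow> path_image (\<gamma> y x) = path_image (\<gamma> x y)"
  by (simp add: reverse_edge)

lemma closed_drawing_subgraph:
  assumes "\<And>x y. E' x y \<Longrightarrow> E x y"
  shows "closed (drawing V E' p \<gamma>)"
proof -
  have "{path_image (\<gamma> x y) | x y. E' x y} \<subseteq> (\<lambda>(x, y). path_image (\<gamma> x y)) ` (V \<times> V)"
    using assms in_V by fastforce
  then have "finite {path_image (\<gamma> x y) | x y. E' x y}"
    using finite_V by (meson finite_SigmaI finite_imageI finite_subset)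
  then have "closed (\<Union> {path_image (\<gamma> x y) | x y. E' x y})"
    using assms by (intro closed_Union) (auto simp: arc_edge closed_arc_image)
  then show ?thesis
    unfolding drawing_def using finite_V by (simp add: closed_Un finite_imp_closed)
qed

lemma drawing_remove_edge:
  assumes "E a b"
  shows "drawing V E p \<gamma> = drawing V (remove_edge E a b) p \<gamma> \<union> path_image (\<gamma> a b)"
proof -
  have "E x y \<longleftrightarrow> remove_edge E a b x y \<or> x = a \<and> y = b \<or> x = b \<and> y = a" for x y
    using assms sym by (auto simp: remove_edge_def doubleton_eq_iff)
  then have "\<Union> {path_image (\<gamma> x y) | x y. E x y} =
      \<Union> {path_image (\<gamma> x y) | x y. remove_edge E a b x y} \<union> path_image (\<gamma> a b) \<union> path_image (\<gamma> b a)"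
    by blast
  then show ?thesis using path_image_edge_commute[OF assms] by (auto simp: drawing_def)
qed

lemma edge_not_covered:
  assumes "E a b"
  obtains q where "q \<in> path_image (\<gamma> a b)" "q \<notin> drawing V (remove_edge E a b) p \<gamma>"
proof -
  define q where "q = \<gamma> a b (1/2)"
  have "inj_on (\<gamma> a b) {0..1}" using arc_edge[OF assms] by (simp add: arc_def)
  then have q_ends: "q \<noteq> p a" "q \<noteq> p b"
    using inj_onD[of "\<gamma> a b" "{0..1}" "1/2" 0] inj_onD[of "\<gamma> a b" "{0..1}" "1/2" 1]
      start_edge[OF assms] finish_edge[OF assms] by (auto simp: q_def pathstart_def pathfinish_def)
  have q: "q \<in> path_image (\<gamma> a b)" by (auto simp: q_def path_image_def)
  have "q \<notin> p ` V" using vertex_off_edge[OF assms] q q_ends by blast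
  moreover have "q \<notin> path_image (\<gamma> x y)" if "remove_edge E a b x y" for x y
    using edges_meet[of x y a b] that assms q q_ends by (auto simp: remove_edge_def)
  ultimately have "q \<notin> drawing V (remove_edge E a b) p \<gamma>" by (auto simp: drawing_def)
  then show thesis using that q by blast
qed

lemma walk_path_arc:
  assumes "distinct xs" "2 \<le> length xs" "successively E xs"
  shows "arc (walk_path \<gamma> xs) \<and> pathstart (walk_path \<gamma> xs) = p (hd xs) \<and>
    pathfinish (walk_path \<gamma> xs) = p (last xs) \<and>
    path_image (walk_path \<gamma> xs) = edge_points \<gamma> (walk_edges xs)"
  using assms
proof (induction xs rule: induct_list012)
  case (3 x y zs)
  have xy: "E x y" and walk: "successively E (y # zs)" using 3 by simp_all
  show ?case
  proof (cases zs)
    case Nil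
    then show ?thesis using xy by (simp add: arc_edge start_edge finish_edge edge_points_def)
  next
    case (Cons z zs')
    let ?ys = "y # zs"
    have tail: "arc (walk_path \<gamma> ?ys)" "pathstart (walk_path \<gamma> ?ys) = p y"
      "pathfinish (walk_path \<gamma> ?ys) = p (last ?ys)"
      "path_image (walk_path \<gamma> ?ys) = edge_points \<gamma> (walk_edges ?ys)"
      using 3 Cons by simp_all
    have "path_image (\<gamma> x y) \<inter> path_image (\<gamma> u v) \<subseteq> {p y}" if uv: "(u, v) \<in> walk_edges ?ys" for u v
    proof -
      have "x \<notin> {u, v}" using walk_edges_in_set[OF uv] 3(3) by auto
      then show ?thesis using edges_meet[OF xy walk_edges_successively[OF walk uv]] by auto
    qed
    then have "path_image (\<gamma> x y) \<inter> path_image (walk_path \<gamma> ?ys) \<subseteq> {pathstart (walk_path \<gamma> ?ys)}"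
      unfolding tail edge_points_def by blast
    then have "arc (\<gamma> x y +++ walk_path \<gamma> ?ys)"
      using xy by (intro arc_join) (simp_all add: tail arc_edge finish_edge)
    then show ?thesis using xy tail unfolding Cons
      by (simp add: start_edge finish_edge path_image_join edge_points_def)
  qed
qed simp_all

lemma cycle_curve:
  assumes "graph_cycle E xs"
  obtains c where "simple_path c" "pathfinish c = pathstart c"
    "path_image c = edge_points \<gamma> (cycle_edges xs)"
proof -
  have xs: "distinct xs" "3 \<le> length xs" "successively E xs" and closing: "E (last xs) (hd xs)"
    using assms by (auto simp: graph_cycle_def)
  let ?a = "walk_path \<gamma> xs" and ?b = "\<gamma> (last xs) (hd xs)"
  have a: "arc ?a" "pathstart ?a = p (hd xs)" "pathfinish ?a = p (last xs)"
    "path_image ?a = edge_points \<gamma> (walk_edges xs)"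
    using walk_path_arc[of xs] xs by auto
  have "path_image ?b \<inter> path_image (\<gamma> u v) \<subseteq> {p (hd xs), p (last xs)}"
    if uv: "(u, v) \<in> walk_edges xs" for u v
    using edges_meet[OF closing walk_edges_successively[OF xs(3) uv]]
      walk_edges_not_closing[OF xs(1,2) uv] by auto
  then have "path_image ?a \<inter> path_image ?b \<subseteq> {pathstart ?a, pathstart ?b}"
    unfolding a start_edge[OF closing] edge_points_def by blast
  then have "simple_path (?a +++ ?b)"
    using closing by (intro simple_path_join_loop) (simp_all add: a arc_edge start_edge finish_edge)
  moreover have "pathfinish (?a +++ ?b) = pathstart (?a +++ ?b)"
    using closing by (simp add: a finish_edge)
  moreover have "path_image (?a +++ ?b) = edge_points \<gamma> (cycle_edges xs)"
    using closing
    by (simp add: path_image_join a start_edge edge_points_def cycle_edges_def Un_commute)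
  ultimately show thesis by (rule that)
qed

abbreviation interior_of_cycle :: "'v list \<Rightarrow> complex set" where
  "interior_of_cycle xs \<equiv> inside (edge_points \<gamma> (cycle_edges xs))"

lemma bounded_interior_of_cycle: "graph_cycle E xs \<Longrightarrow> bounded (interior_of_cycle xs)"
  and frontier_interior_of_cycle:
    "graph_cycle E xs \<Longrightarrow> frontier (interior_of_cycle xs) = edge_points \<gamma> (cycle_edges xs)"
  using cycle_curve Jordan_inside_outside by metis+

lemma cycle_points_subset_drawing:
  "graph_cycle E xs \<Longrightarrow> edge_points \<gamma> (cycle_edges xs) \<subseteq> drawing V E p \<gamma>"
  by (intro edge_points_subset_drawing) (rule cycle_edges_edge)

lemma interior_of_cycle_psubset:
  assumes xs: "graph_cycle E xs" and ys: "graph_cycle E ys"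
    and sub: "edge_points \<gamma> (cycle_edges ys) \<subseteq> edge_points \<gamma> (cycle_edges xs) \<union> interior_of_cycle xs"
    and ab: "(a, b) \<in> cycle_edges xs" "\<And>u v. (u, v) \<in> cycle_edges ys \<Longrightarrow> {u, v} \<noteq> {a, b}"
  shows "interior_of_cycle ys \<subset> interior_of_cycle xs"
proof -
  obtain q where q: "q \<in> path_image (\<gamma> a b)" "q \<notin> drawing V (remove_edge E a b) p \<gamma>"
    using edge_not_covered cycle_edges_edge[OF xs ab(1)] by blast
  have "edge_points \<gamma> (cycle_edges ys) \<subseteq> drawing V (remove_edge E a b) p \<gamma>"
    using ab(2) cycle_edges_edge[OF ys]
    by (intro edge_points_subset_drawing) (simp add: remove_edge_def)
  moreover have "q \<in> edge_points \<gamma> (cycle_edges xs)" using q(1) ab(1) by (auto simp: edge_points_def)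
  ultimately have "edge_points \<gamma> (cycle_edges ys) \<noteq> edge_points \<gamma> (cycle_edges xs)" using q(2) by blast
  moreover obtain c where "simple_path c" "pathfinish c = pathstart c"
    "path_image c = edge_points \<gamma> (cycle_edges xs)" using cycle_curve[OF xs] .
  moreover obtain d where "simple_path d" "pathfinish d = pathstart d"
    "path_image d = edge_points \<gamma> (cycle_edges ys)" using cycle_curve[OF ys] .
  ultimately show ?thesis using inside_curve_psubset[of c d] sub by simp
qed

lemma interior_of_cycle_psubset_across_triangle:
  assumes xs: "graph_cycle E xs" and ys: "graph_cycle E ys"
    and d: "E (last xs) d" "E d (hd xs)"
    and sides: "path_image (\<gamma> (last xs) d) \<union> path_image (\<gamma> d (hd xs)) \<subseteq>
      edge_points \<gamma> (cycle_edges xs) \<union> interior_of_cycle xs"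
    and ys_edges: "cycle_edges ys \<subseteq> walk_edges xs \<union> {(last xs, d), (d, hd xs)}"
  shows "interior_of_cycle ys \<subset> interior_of_cycle xs"
proof (rule interior_of_cycle_psubset[OF xs ys])
  have "edge_points \<gamma> (cycle_edges ys) \<subseteq> edge_points \<gamma> (walk_edges xs \<union> {(last xs, d), (d, hd xs)})"
    using ys_edges by (rule edge_points_mono)
  also have "\<dots> \<subseteq> edge_points \<gamma> (cycle_edges xs) \<union>
      (path_image (\<gamma> (last xs) d) \<union> path_image (\<gamma> d (hd xs)))"
    by (auto simp: edge_points_def cycle_edges_def)
  finally show "edge_points \<gamma> (cycle_edges ys) \<subseteq> edge_points \<gamma> (cycle_edges xs) \<union> interior_of_cycle xs"
    using sides by blast
  show "(last xs, hd xs) \<in> cycle_edges xs" by (simp add: cycle_edges_def)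
  fix u v assume "(u, v) \<in> cycle_edges ys"
  then consider (walk) "(u, v) \<in> walk_edges xs" | (side) "d \<in> {u, v}" using ys_edges by auto
  then show "{u, v} \<noteq> {last xs, hd xs}"
  proof cases
    case walk
    then show ?thesis using walk_edges_not_closing[of xs u v] xs by (simp add: graph_cycle_def)
  next
    case side
    moreover have "d \<notin> {last xs, hd xs}" using d irrefl by blast
    ultimately show ?thesis by blast
  qed
qed

lemma face_subset_interior_of_cycle:
  assumes xs: "graph_cycle E xs" and F: "F \<in> faces V E p \<gamma>" "F \<inter> interior_of_cycle xs \<noteq> {}"
  shows "F \<subseteq> interior_of_cycle xs"
proof -
  have "connected F" "F \<subseteq> - drawing V E p \<gamma>"
    using F(1) connected_component_subset by (auto simp: faces_def)
  then have "connected F" "F \<inter> frontier (interior_of_cycle xs) = {}"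
    using frontier_interior_of_cycle[OF xs] cycle_points_subset_drawing[OF xs] by blast+
  then show ?thesis using connected_Int_frontier[of F "interior_of_cycle xs"] F(2) by blast
qed

lemma face_at_cycle_edge:
  assumes xs: "graph_cycle E xs" and ab: "(a, b) \<in> cycle_edges xs"
  obtains F r where "F \<in> faces V E p \<gamma>" "F \<subseteq> interior_of_cycle xs" "r \<in> frontier F"
    "r \<notin> drawing V (remove_edge E a b) p \<gamma>"
proof -
  let ?rest = "drawing V (remove_edge E a b) p \<gamma>"
  have "E a b" using cycle_edges_edge[OF xs ab] .
  then obtain q where q: "q \<in> path_image (\<gamma> a b)" "q \<notin> ?rest" by (rule edge_not_covered)
  have "closed ?rest" by (rule closed_drawing_subgraph) (simp add: remove_edge_def)
  then obtain \<epsilon> where \<epsilon>: "\<epsilon> > 0" "ball q \<epsilon> \<subseteq> - ?rest"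
    using q(2) by (metis ComplI open_Compl open_contains_ball)
  have ab_cycle: "path_image (\<gamma> a b) \<subseteq> edge_points \<gamma> (cycle_edges xs)"
    using ab by (auto simp: edge_points_def)
  then have "q \<in> closure (interior_of_cycle xs)"
    using q(1) frontier_interior_of_cycle[OF xs] by (auto simp: frontier_def)
  then obtain z where z: "z \<in> interior_of_cycle xs" "z \<in> ball q \<epsilon>"
    using \<epsilon>(1) by (auto simp: closure_approachable dist_commute)
  have "z \<notin> edge_points \<gamma> (cycle_edges xs)" using z(1) inside_no_overlap by blast
  then have z_face: "z \<notin> drawing V E p \<gamma>"
    using drawing_remove_edge[OF \<open>E a b\<close>] ab_cycle z(2) \<epsilon>(2) by blast
  define F where "F = connected_component_set (- drawing V E p \<gamma>) z"
  have F: "F \<in> faces V E p \<gamma>" and "z \<in> F" using z_face by (auto simp: F_def faces_def)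
  then have F_inside: "F \<subseteq> interior_of_cycle xs"
    using face_subset_interior_of_cycle[OF xs] z(1) by blast
  have "q \<notin> F"
    using F_inside ab_cycle q(1) inside_no_overlap[of "edge_points \<gamma> (cycle_edges xs)"] by blast
  then have "closed_segment z q \<inter> frontier F \<noteq> {}"
    using \<open>z \<in> F\<close> by (intro connected_Int_frontier) auto
  then obtain r where r: "r \<in> closed_segment z q" "r \<in> frontier F" by blast
  have "closed_segment z q \<subseteq> ball q \<epsilon>" using z(2) \<epsilon>(1) by (intro closed_segment_subset) auto
  then have "r \<notin> ?rest" using r(1) \<epsilon>(2) by blast
  then show thesis using that F F_inside r(2) by blast
qed

lemma finite_graph_cycles: "finite {xs. graph_cycle E xs}"
proof -
  have "x \<in> V" if "graph_cycle E xs" "x \<in> set xs" for xs x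
  proof -
    obtain us vs where "xs = us @ x # vs" using \<open>x \<in> set xs\<close> by (meson split_list)
    then show ?thesis
      using that(1) in_V by (cases vs) (auto simp: graph_cycle_def successively_append_iff)
  qed
  then have "{xs. graph_cycle E xs} \<subseteq> {xs. set xs \<subseteq> V \<and> distinct xs}"
    by (auto simp: graph_cycle_def)
  then show ?thesis using finite_subset_distinct[OF finite_V] finite_subset by blast
qed

end

locale plane_near_triangulation = plane_graph V E p \<gamma>
  for V :: "'v set" and E :: "'v \<Rightarrow> 'v \<Rightarrow> bool"
    and p :: "'v \<Rightarrow> complex" and \<gamma> :: "'v \<Rightarrow> 'v \<Rightarrow> real \<Rightarrow> complex" +
  assumes triangular_inner_face: "F \<in> faces V E p \<gamma> \<Longrightarrow> bounded F \<Longrightarrow> triangular_face V E \<gamma> F"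
begin

lemma triangle_at_cycle_edge:
  assumes xs: "graph_cycle E xs" and ab: "(a, b) \<in> cycle_edges xs"
  obtains d where "E a d" "E d b"
    "path_image (\<gamma> a d) \<union> path_image (\<gamma> d b) \<subseteq>
       edge_points \<gamma> (cycle_edges xs) \<union> interior_of_cycle xs"
proof -
  obtain F r where F: "F \<in> faces V E p \<gamma>" "F \<subseteq> interior_of_cycle xs"
    and r: "r \<in> frontier F" "r \<notin> drawing V (remove_edge E a b) p \<gamma>"
    using face_at_cycle_edge[OF xs ab] by metis
  have "bounded F" using F(2) bounded_interior_of_cycle[OF xs] bounded_subset by blast
  then have "triangular_face V E \<gamma> F" by (rule triangular_inner_face[OF F(1)])
  then obtain x y d where triangle: "E x y" "E y d" "E d x" and "r \<in> path_image (\<gamma> x y)"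
    and sides: "path_image (\<gamma> y d) \<union> path_image (\<gamma> d x) \<subseteq> frontier F"
    using r(1) by (rule triangular_face_frontier_pointE)
  have "\<not> remove_edge E a b x y"
    using r(2) \<open>r \<in> path_image (\<gamma> x y)\<close> by (auto simp: drawing_def)
  then have "x = a \<and> y = b \<or> x = b \<and> y = a"
    using triangle(1) by (auto simp: remove_edge_def doubleton_eq_iff)
  then have "E a d" "E d b" "path_image (\<gamma> a d) \<union> path_image (\<gamma> d b) \<subseteq> frontier F"
    using triangle sides sym path_image_edge_commute[OF triangle(2)]
      path_image_edge_commute[OF triangle(3)]
    by auto
  moreover have "frontier F \<subseteq> edge_points \<gamma> (cycle_edges xs) \<union> interior_of_cycle xs"
  proof -
    have "frontier F \<subseteq> closure (interior_of_cycle xs)"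
      using closure_mono[OF F(2)] by (auto simp: frontier_def)
    then show ?thesis
      using frontier_interior_of_cycle[OF xs] closure_Un_frontier[of "interior_of_cycle xs"] by blast
  qed
  ultimately show thesis using that by blast
qed

lemma graph_cycle_shrink:
  assumes cocycle: "edge_cocycle E g"
    and xs: "graph_cycle E xs" "cycle_sum g xs \<noteq> 0"
  obtains ys where "graph_cycle E ys" "cycle_sum g ys \<noteq> 0"
    "interior_of_cycle ys \<subset> interior_of_cycle xs"
proof -
  let ?a = "last xs" and ?b = "hd xs"
  have closing: "(?a, ?b) \<in> cycle_edges xs" by (simp add: cycle_edges_def)
  then have "E ?a ?b" by (rule cycle_edges_edge[OF xs(1)])
  obtain d where d: "E ?a d" "E d ?b"
    and sides: "path_image (\<gamma> ?a d) \<union> path_image (\<gamma> d ?b) \<subseteq>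
       edge_points \<gamma> (cycle_edges xs) \<union> interior_of_cycle xs"
    using triangle_at_cycle_edge[OF xs(1) closing] .
  have cochain: "edge_cochain E g" using cocycle by (simp add: edge_cocycle_def)
  have "g ?a d + g d ?b + g ?b ?a = 0"
    using cocycle d sym[OF \<open>E ?a ?b\<close>] unfolding edge_cocycle_def by blast
  then have sum: "g ?a ?b = g ?a d + g d ?b"
    using edge_cochainD[OF cochain \<open>E ?a ?b\<close>] by (simp add: algebra_simps)
  obtain ys where ys: "graph_cycle E ys" "cycle_sum g ys \<noteq> 0"
    and ys_edges: "cycle_edges ys \<subseteq> walk_edges xs \<union> {(?a, d), (d, ?b)}"
    using graph_cycle_across_triangle[OF cochain irrefl xs d sum] by blast
  have "interior_of_cycle ys \<subset> interior_of_cycle xs"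
    using xs(1) ys(1) d sides ys_edges by (rule interior_of_cycle_psubset_across_triangle)
  then show thesis using that ys by blast
qed

lemma edge_cocycle_imp_coboundary:
  fixes g :: "'v \<Rightarrow> 'v \<Rightarrow> 'a::ab_group_add"
  assumes cocycle: "edge_cocycle E g"
  shows "edge_coboundary E g"
proof (rule edge_coboundary_if_cycle_sums_0[OF graph])
  show "edge_cochain E g" using cocycle by (simp add: edge_cocycle_def)
  let ?inner = "\<lambda>xs. {ys. graph_cycle E ys \<and> interior_of_cycle ys \<subset> interior_of_cycle xs}"
  show "cycle_sum g xs = 0" if "graph_cycle E xs" for xs
    using that
  proof (induction "card (?inner xs)" arbitrary: xs rule: less_induct)
    case less
    show ?case
    proof (rule ccontr)
      assume "cycle_sum g xs \<noteq> 0"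
      with cocycle less.prems obtain ys where ys: "graph_cycle E ys" "cycle_sum g ys \<noteq> 0"
        and shrink: "interior_of_cycle ys \<subset> interior_of_cycle xs" by (rule graph_cycle_shrink)
      have "finite (?inner xs)" by (rule finite_subset[OF _ finite_graph_cycles]) auto
      moreover have "?inner ys \<subset> ?inner xs"
      proof
        show "?inner ys \<subseteq> ?inner xs" using shrink by auto
        have "ys \<in> ?inner xs - ?inner ys" using ys(1) shrink by simp
        then show "?inner ys \<noteq> ?inner xs" by blast
      qed
      ultimately have "card (?inner ys) < card (?inner xs)" by (rule psubset_card_mono)
      then show False using less.hyps ys by blast
    qed
  qed
qed

lemma ex_antisymmetric_local_two_colouring:
  assumes "local_two_colouring E b"
  shows "\<exists>b'. local_two_colouring E b' \<and> (\<forall>x y. E x y \<longrightarrow> b' x y \<noteq> b' y x)"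
proof -
  define \<beta> :: "'v \<Rightarrow> 'v \<Rightarrow> bit" where "\<beta> x y = of_bool (b x y)" for x y
  have \<beta>: "\<beta> v x + \<beta> v y = 1" if "E v x" "E v y" "E x y" for v x y
    using assms that by (auto simp: \<beta>_def local_two_colouring_def)
  have "edge_cocycle E (\<lambda>x y. \<beta> x y + \<beta> y x + 1)"
    unfolding edge_cocycle_def edge_cochain_def
  proof (intro conjI allI impI)
    fix x y z assume xyz: "E x y" "E y z" "E z x"
    have "(\<beta> x y + \<beta> y x + 1) + (\<beta> y z + \<beta> z y + 1) + (\<beta> z x + \<beta> x z + 1) =
      (\<beta> x y + \<beta> x z) + (\<beta> y x + \<beta> y z) + (\<beta> z x + \<beta> z y) + (1 + 1 + 1)"
      by (simp only: ac_simps)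
    also have "\<dots> = 0" using \<beta>[of x y z] \<beta>[of y x z] \<beta>[of z x y] xyz sym by simp
    finally show "(\<beta> x y + \<beta> y x + 1) + (\<beta> y z + \<beta> z y + 1) + (\<beta> z x + \<beta> x z + 1) = 0" .
  qed (simp add: add.commute)
  then obtain f where f: "\<And>x y. E x y \<Longrightarrow> \<beta> x y + \<beta> y x + 1 = f y - f x"
    using edge_cocycle_imp_coboundary unfolding edge_coboundary_def by blast
  define b' where "b' x y \<longleftrightarrow> b x y \<noteq> (f x = 1)" for x y
  have "b' x y \<noteq> b' y x" if "E x y" for x y
    using f[OF that] by (cases "f x"; cases "f y") (auto simp: b'_def \<beta>_def split: if_splits)
  moreover have "local_two_colouring E b'"
    using assms by (auto simp: local_two_colouring_def b'_def)
  ultimately show ?thesis by blast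
qed

lemma three_colourable_if_local_two_colouring:
  assumes "local_two_colouring E b"
  shows "three_colourable V E"
proof -
  obtain b' where b': "local_two_colouring E b'" and anti: "\<And>x y. E x y \<Longrightarrow> b' x y \<noteq> b' y x"
    using ex_antisymmetric_local_two_colouring[OF assms] by blast
  define g :: "'v \<Rightarrow> 'v \<Rightarrow> 3" where "g x y = (if b' x y then 1 else - 1)" for x y
  have "edge_cocycle E g"
    unfolding edge_cocycle_def edge_cochain_def
  proof (intro conjI allI impI)
    show "g y x = - g x y" if "E x y" for x y using anti[OF that] by (simp add: g_def)
    fix x y z assume xyz: "E x y" "E y z" "E z x"
    then have "b' y x \<noteq> b' y z" "b' z y \<noteq> b' z x"
      using b' sym unfolding local_two_colouring_def by blast+
    then have "g x y = g y z" "g y z = g z x" using anti xyz by (auto simp: g_def)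
    then show "g x y + g y z + g z x = 0" by (simp add: g_def)
  qed
  then obtain h where h: "\<And>x y. E x y \<Longrightarrow> g x y = h y - h x"
    using edge_cocycle_imp_coboundary unfolding edge_coboundary_def by blast
  obtain colour :: "3 \<Rightarrow> nat" where colour: "bij_betw colour UNIV {0..<3}"
    using ex_bij_betw_finite_nat[of "UNIV :: 3 set"] by auto
  define c where "c v = colour (h v)" for v
  have "h x \<noteq> h y" if "E x y" for x y using h[OF that] by (auto simp: g_def split: if_splits)
  then have "c x \<noteq> c y" if "E x y" for x y
    using that bij_betw_imp_inj_on[OF colour] by (simp add: c_def inj_eq)
  moreover have "c v < 3" for v using bij_betwE[OF colour] by (simp add: c_def)
  ultimately show ?thesis unfolding three_colourable_def by blast
qed

end

theorem theorem2:
  fixes V :: "'v set" and E :: "'v \<Rightarrow> 'v \<Rightarrow> bool"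
  assumes "near_triangulation V E"
    and "\<not> has_induced_K4 V E"
  shows "three_colourable V E \<longleftrightarrow> word_representable V E"
proof
  have graph: "simple_graph V E" using assms(1) by (simp add: near_triangulation_def)
  show "word_representable V E" if "three_colourable V E"
    using graph that by (rule three_colourable_imp_word_representable)
  assume "word_representable V E"
  then obtain l :: "'v \<Rightarrow> 'v \<Rightarrow> nat \<Rightarrow> int" where "local_comparability E l"
    using word_representable_imp_local_comparability[OF graph] by blast
  with graph assms(2) have "local_two_colouring E (\<lambda>v x. \<exists>y. E v y \<and> l v y < l v x)"
    by (rule local_comparability_imp_local_two_colouring)
  moreover obtain p \<gamma> where "plane_near_triangulation V E p \<gamma>"
    using assms(1)
    by (auto simp: near_triangulation_def plane_near_triangulation_def plane_graph_def
        plane_near_triangulation_axioms_def)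
  ultimately show "three_colourable V E"
    by (intro plane_near_triangulation.three_colourable_if_local_two_colouring)
qed

end
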